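(* Let $n\ge 1$, let $\mathbf{x}=(x_0,x_1,\dots,x_n)\in\mathcal{X}^{n+1}$ be any sequence of contexts, and let $\pi$ be any Weighted ERM policy. Then $$ \mathsf{Reg}_n(\pi,\mathbf{x})=\max\Big\{\sup_{\mu_0\in[0,1-q]}\mathbb{E}_{\mathbf{y}\sim\mathcal{B}(\mu_0+d(x_0,x_1))\times\cdots\times\mathcal{B}(\mu_0+d(x_0,x_n))}\big[R(\pi(\mathbf{x},\mathbf{y}),\mathcal{B}(\mu_0))\big],\ \sup_{\mu_0\in[1-q,1]}\mathbb{E}_{\mathbf{y}\sim\mathcal{B}(\mu_0-d(x_0,x_1))\times\cdots\times\mathcal{B}(\mu_0-d(x_0,x_n))}\big[R(\pi(\mathbf{x},\mathbf{y}),\mathcal{B}(\mu_0))\big]\Big\}. $$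
   Context: Let $\mathcal{Y}=[0,1]$ and let $\Delta(\mathcal{Y})$ be the set of probability distributions on $\mathcal{Y}$; an element $F\in\Delta(\mathcal{Y})$ is identified with its cumulative distribution function (cdf). Let $\mathcal{X}$ be a set (of contexts) and $d:\mathcal{X}\times\mathcal{X}\to\mathbb{R}$ a non-negative function (the dissimilarity). Costs $c_o,c_u>0$ satisfy $c_o+c_u=1$, and $q=c_u/(c_u+c_o)$. Newsvendor loss: $\ell(a,y)=c_o(a-y)^+ + c_u(y-a)^+$ for $a,y\in\mathcal{Y}$, where $z^+=\max(0,z)$. For $a\in\mathcal{Y}$, $F_0\in\Delta(\mathcal{Y})$: $L(a,F_0)=\mathbb{E}_{y\sim F_0}[\ell(a,y)]$, $a^*_{F_0}=\inf\{a\in\mathcal{Y}: F_0(a)\ge q\}$, and the regret is $R(a,F_0)=L(a,F_0)-L(a^*_{F_0},F_0)$. Weighted ERM policy: given weights $w_i=w_i(\mathbf{x})\ge 0$, $i=1,\dots,n$ (possibly depending on the fixed contexts $\mathbf{x}$), with $\sum_j w_j>0$, it is the deterministic policy mapping $\mathbf{y}=(y_1,\dots,y_n)\in\mathcal{Y}^n$ to $$\pi^{\mathbf{w}}(\mathbf{x},\mathbf{y})=\inf\Big\{a:\ \frac{\sum_{i=1}^n w_i\mathbf{1}\{y_i\le a\}}{\sum_{j=1}^n w_j}\ge\frac{c_u}{c_u+c_o}\Big\}.$$ Kolmogorov distance: $\|F-F'\|_K=\sup_{y\in\mathbb{R}}|F(y)-F'(y)|$. Worst-case regret: $$\mathsf{Reg}_n(\pi,\mathbf{x})=\sup_{F_0\in\Delta(\mathcal{Y})}\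 \sup_{\substack{F_1,\dots,F_n\in\Delta(\mathcal{Y})\\ \|F_0-F_i\|_K\le d(x_0,x_i)\ \forall i\in\{1,\dots,n\}}}\mathbb{E}_{\mathbf{y}\sim F_1\times\cdots\times F_n}\big[R(\pi(\mathbf{x},\mathbf{y}),F_0)\big].$$ For $\mu\in\mathbb{R}$, $\mathcal{B}(\mu)$ denotes the Bernoulli distribution on $\{0,1\}$ with mean $\min(\max(\mu,0),1)$ (i.e. $\mu$ clipped to $[0,1]$). *)

theory Defs
  imports "HOL-Probability.Probability"
begin

text \<open>Probability distributions on $[0,1]$, represented as Borel probability measures on the
  real line that give full mass to the unit interval; \<^const>\<open>cdf\<close> is then the usual cumulative
  distribution function on the whole real line.\<close>

definition unit_dists :: "real measure set" where
  "unit_dists = {F. real_distribution F \<and> measure F {0..1} = 1}"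

definition newsvendor_loss :: "real \<Rightarrow> real \<Rightarrow> real \<Rightarrow> real \<Rightarrow> real" where
  "newsvendor_loss c_o c_u a y = c_o * max 0 (a - y) + c_u * max 0 (y - a)"

definition critical_ratio :: "real \<Rightarrow> real \<Rightarrow> real" where
  "critical_ratio c_o c_u = c_u / (c_u + c_o)"

definition expected_loss :: "real \<Rightarrow> real \<Rightarrow> real \<Rightarrow> real measure \<Rightarrow> real" where
  "expected_loss c_o c_u a F = (\<integral>y. newsvendor_loss c_o c_u a y \<partial>F)"

definition opt_action :: "real \<Rightarrow> real \<Rightarrow> real measure \<Rightarrow> real" where
  "opt_action c_o c_u F = Inf {a \<in> {0..1}. cdf F a \<ge> critical_ratio c_o c_u}"

definition regret :: "real \<Rightarrow> real \<Rightarrow> real \<Rightarrow> real measure \<Rightarrow> real" where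
  "regret c_o c_u a F = expected_loss c_o c_u a F - expected_loss c_o c_u (opt_action c_o c_u F) F"

text \<open>A sequence of contexts $(x_0,\ldots,x_n)$ is a function on the naturals of which only the
  values at $0,\ldots,n$ matter, and a sample $(y_1,\ldots,y_n)$ one of which only the values at
  $1,\ldots,n$ matter. The weights may depend on the contexts but not on the sample.

  The infimum below ranges over all real $a$. For samples in $[0,1]^n$ and admissible weights it is
  one of the $y_i$, so intersecting with $[0,1]$ would not change it.\<close>

definition weighted_erm ::
  "real \<Rightarrow> real \<Rightarrow> nat \<Rightarrow> ((nat \<Rightarrow> 'x) \<Rightarrow> nat \<Rightarrow> real) \<Rightarrow> (nat \<Rightarrow> 'x) \<Rightarrow> (nat \<Rightarrow> real) \<Rightarrow> real" where
  "weighted_erm c_o c_u n w x y =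
     Inf {a. (\<Sum>i = 1..n. w x i * of_bool (y i \<le> a)) / (\<Sum>j = 1..n. w x j)
               \<ge> critical_ratio c_o c_u}"

definition kolmogorov_dist :: "real measure \<Rightarrow> real measure \<Rightarrow> real" where
  "kolmogorov_dist F G = (SUP y. \<bar>cdf F y - cdf G y\<bar>)"

definition expected_regret ::
  "real \<Rightarrow> real \<Rightarrow> nat \<Rightarrow> ((nat \<Rightarrow> 'x) \<Rightarrow> (nat \<Rightarrow> real) \<Rightarrow> real) \<Rightarrow> (nat \<Rightarrow> 'x)
     \<Rightarrow> real measure \<Rightarrow> (nat \<Rightarrow> real measure) \<Rightarrow> real" where
  "expected_regret c_o c_u n \<pi> x F\<^sub>0 F =
     (\<integral>y. regret c_o c_u (\<pi> x y) F\<^sub>0 \<partial>(Pi\<^sub>M {1..n} F))"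

definition ambiguity_set ::
  "nat \<Rightarrow> ('x \<Rightarrow> 'x \<Rightarrow> real) \<Rightarrow> (nat \<Rightarrow> 'x) \<Rightarrow> real measure \<Rightarrow> (nat \<Rightarrow> real measure) set" where
  "ambiguity_set n d x F\<^sub>0 =
     {F. \<forall>i\<in>{1..n}. F i \<in> unit_dists \<and> kolmogorov_dist F\<^sub>0 (F i) \<le> d (x 0) (x i)}"

text \<open>The suprema are taken in the reals: for actions in $[0,1]$ the regret lies between $0$ and
  $\max(c_o, c_u)$, and for $d \ge 0$ the constant family $F_i = F_0$ is always admissible.\<close>

definition worst_case_regret ::
  "real \<Rightarrow> real \<Rightarrow> ('x \<Rightarrow> 'x \<Rightarrow> real) \<Rightarrow> nat
     \<Rightarrow> ((nat \<Rightarrow> 'x) \<Rightarrow> (nat \<Rightarrow> real) \<Rightarrow> real) \<Rightarrow> (nat \<Rightarrow> 'x) \<Rightarrow> real" where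
  "worst_case_regret c_o c_u d n \<pi> x =
     (SUP F\<^sub>0\<in>unit_dists. SUP F\<in>ambiguity_set n d x F\<^sub>0. expected_regret c_o c_u n \<pi> x F\<^sub>0 F)"

definition bernoulli_dist :: "real \<Rightarrow> real measure" where
  "bernoulli_dist \<mu> = distr (measure_pmf (bernoulli_pmf (min (max \<mu> 0) 1))) borel of_bool"

end

theory Submission
  imports Defs
begin

text \<open>Since $c_o + c_u = 1$, the regret is
  $R(a, F_0) = \int_0^1 (F_0(t) - q) (1\{q \le F_0(t)\} - 1\{a \le t\})\,dt$, and the weighted ERM
  action is at most $t$ iff the samples $y_i \le t$ carry at least a fraction $q$ of the weight.
  By Fubini the expected regret is therefore the integral over $t \in [0,1)$ of a function of the
  numbers $F_0(t), F_1(t), \ldots, F_n(t)$ alone. It is monotone in each $F_i(t)$, decreasing if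
  $F_0(t) \ge q$ and increasing otherwise, so at each $t$ it is largest when $F_i(t)$ is
  $F_0(t) \mp d(x_0, x_i)$ clipped to $[0,1]$. For Bernoulli distributions the cdfs are constant on
  $[0,1)$, so each of these pointwise maxima is the expected regret of the Bernoulli instance with
  $\mu_0 = 1 - F_0(t)$.\<close>

section \<open>Infima of superlevel sets\<close>

text \<open>Right continuity makes the infimum attained: if \<open>g t < q\<close>, then
  \<open>g\<close> stays below \<open>q\<close> on some interval to the right of \<open>t\<close>,
  and by monotonicity the whole superlevel set lies beyond it. Applied to a cdf this handles the
  optimal action, applied to the cumulative weight of a sample the weighted ERM action.\<close>

lemma Inf_superlevel_le_iff:
  fixes g :: "real \<Rightarrow> real"
  assumes "mono g" and rc: "continuous (at_right t) g"
    and ne: "{a. q \<le> g a} \<noteq> {}" and bdd: "bdd_below {a. q \<le> g a}"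
  shows "Inf {a. q \<le> g a} \<le> t \<longleftrightarrow> q \<le> g t"
proof
  assume "q \<le> g t"
  then show "Inf {a. q \<le> g a} \<le> t"
    using bdd by (intro cInf_lower) auto
next
  assume le: "Inf {a. q \<le> g a} \<le> t"
  show "q \<le> g t"
  proof (rule ccontr)
    assume "\<not> q \<le> g t"
    moreover have "(g \<longlongrightarrow> g t) (at_right t)"
      using rc by (simp add: continuous_within)
    ultimately have "\<forall>\<^sub>F a in at_right t. g a < q"
      by (intro order_tendstoD) auto
    then obtain b where "t < b" and b: "\<And>a. t < a \<Longrightarrow> a < b \<Longrightarrow> g a < q"
      by (auto simp: eventually_at_right_field)
    have "b \<le> a" if "q \<le> g a" for a
    proof (rule ccontr)
      assume "\<not> b \<le> a"
      \<comment> \<open>The point \<open>a\<close> may lie left of \<open>t\<close>; raising it to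
        at least the midpoint of \<open>t\<close> and \<open>b\<close> puts it inside the interval
        without decreasing \<open>g\<close>.\<close>
      then have "t < max a ((t + b) / 2)" "max a ((t + b) / 2) < b"
        using \<open>t < b\<close> by (simp_all add: less_max_iff_disj field_simps)
      then have "g (max a ((t + b) / 2)) < q"
        by (rule b)
      moreover have "g a \<le> g (max a ((t + b) / 2))"
        by (rule monoD[OF \<open>mono g\<close>]) simp
      ultimately show False
        using that by simp
    qed
    then have "b \<le> Inf {a. q \<le> g a}"
      using ne by (intro cInf_greatest) auto
    then show False
      using le \<open>t < b\<close> by simp
  qed
qed

lemma continuous_at_right_of_bool_le:
  fixes y t :: real
  shows "continuous (at_right t) (\<lambda>a. of_bool (y \<le> a) :: real)"
proof -
  have "\<forall>\<^sub>F a in at_right t. of_bool (y \<le> t) = (of_bool (y \<le> a) :: real)"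
  proof (cases "y \<le> t")
    case True
    then show ?thesis
      by (auto simp: eventually_at_right_field intro!: exI[of _ "t + 1"])
  next
    case False
    then show ?thesis
      by (auto simp: eventually_at_right_field intro!: exI[of _ y])
  qed
  then show ?thesis
    unfolding continuous_within by (rule tendsto_eventually[OF eventually_mono]) auto
qed

section \<open>Expectations over independent random subsets\<close>

text \<open>For \<open>p i\<close> in [0,1] and finite \<open>I\<close> this is the mean of
  \<open>f S\<close> when the random set \<open>S\<close> contains each \<open>i\<close> in
  \<open>I\<close> independently with probability \<open>p i\<close>, that is, the multilinear
  extension of \<open>f\<close>.\<close>

definition subset_expectation :: "'i set \<Rightarrow> ('i \<Rightarrow> real) \<Rightarrow> ('i set \<Rightarrow> real) \<Rightarrow> real" where
  "subset_expectation I p f = (\<Sum>S\<in>Pow I. f S * (\<Prod>i\<in>I. if i \<in> S then p i else 1 - p i))"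

lemma subset_expectation_cong:
  assumes "\<And>i. i \<in> I \<Longrightarrow> p i = p' i" "\<And>S. S \<subseteq> I \<Longrightarrow> f S = f' S"
  shows "subset_expectation I p f = subset_expectation I p' f'"
  unfolding subset_expectation_def using assms
  by (intro sum.cong arg_cong2[where f="(*)"] prod.cong) auto

text \<open>Condition on whether \<open>i\<close> is selected: \<open>Pow (insert i I)\<close>
  splits into the sets without \<open>i\<close> and those with \<open>i\<close>, and the factor for
  \<open>i\<close> comes out of each product. This drives the inductions over
  \<open>I\<close>.\<close>

lemma subset_expectation_insert:
  assumes "finite I" "i \<notin> I"
  shows "subset_expectation (insert i I) p f =
    p i * subset_expectation I p (\<lambda>S. f (insert i S)) + (1 - p i) * subset_expectation I p f"
proof -
  let ?P = "\<lambda>J S. \<Prod>j\<in>J. if j \<in> S then p j else 1 - p j"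
  have inj: "inj_on (insert i) (Pow I)"
    using \<open>i \<notin> I\<close> by (auto simp: inj_on_def)
  have disj: "Pow I \<inter> insert i ` Pow I = {}"
    using \<open>i \<notin> I\<close> by auto
  have 1: "?P (insert i I) S = (1 - p i) * ?P I S" if "S \<subseteq> I" for S
    using assms that by auto
  have 2: "?P (insert i I) (insert i S) = p i * ?P I S" if "S \<subseteq> I" for S
  proof -
    have "?P I (insert i S) = ?P I S"
      using assms by (intro prod.cong) auto
    then show ?thesis
      using assms by simp
  qed
  show ?thesis
  proof -
    have "(\<Sum>S\<in>Pow (insert i I). f S * ?P (insert i I) S) =
        (\<Sum>S\<in>Pow I. f S * ?P (insert i I) S) + (\<Sum>S\<in>insert i ` Pow I. f S * ?P (insert i I) S)"
      unfolding Pow_insert using assms disj by (intro sum.union_disjoint) auto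
    also have "(\<Sum>S\<in>Pow I. f S * ?P (insert i I) S) = (\<Sum>S\<in>Pow I. (1 - p i) * (f S * ?P I S))"
      using 1 by (intro sum.cong) (auto simp del: prod.insert)
    also have "(\<Sum>S\<in>insert i ` Pow I. f S * ?P (insert i I) S) =
        (\<Sum>S\<in>Pow I. p i * (f (insert i S) * ?P I S))"
      unfolding sum.reindex[OF inj] o_def using 2 by (intro sum.cong) (auto simp del: prod.insert insert_iff)
    finally show ?thesis
      by (simp add: subset_expectation_def sum_distrib_left)
  qed
qed

lemma subset_expectation_mono_fun:
  assumes "\<And>i. i \<in> I \<Longrightarrow> p i \<in> {0..1}" "\<And>S. S \<subseteq> I \<Longrightarrow> f S \<le> g S"
  shows "subset_expectation I p f \<le> subset_expectation I p g"
  unfolding subset_expectation_def using assms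
  by (intro sum_mono mult_right_mono prod_nonneg) auto

lemma subset_expectation_const:
  assumes "finite I"
  shows "subset_expectation I p (\<lambda>_. c) = c"
  using assms
proof (induction I rule: finite_induct)
  case empty
  show ?case
    by (simp add: subset_expectation_def)
next
  case (insert i I)
  then show ?case
    by (simp add: subset_expectation_insert algebra_simps)
qed

text \<open>By \<open>subset_expectation_insert\<close> the value is affine in each single
  probability, and for increasing \<open>f\<close> the slope is nonnegative. The induction
  generalises over \<open>f\<close> because conditioning on \<open>i\<close> being selected replaces
  \<open>f S\<close> by \<open>f (insert i S)\<close>.\<close>

lemma subset_expectation_mono:
  assumes "finite I" "\<And>i. i \<in> I \<Longrightarrow> 0 \<le> p i \<and> p i \<le> p' i \<and> p' i \<le> 1"
    and "\<And>S T. S \<subseteq> T \<Longrightarrow> T \<subseteq> I \<Longrightarrow> f S \<le> f T"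
  shows "subset_expectation I p f \<le> subset_expectation I p' f"
  using assms
proof (induction I arbitrary: f rule: finite_induct)
  case empty
  show ?case
    by (simp add: subset_expectation_def)
next
  case (insert i I)
  let ?E = "subset_expectation I"
  let ?f = "\<lambda>S. f (insert i S)"
  have f: "?E p ?f \<le> ?E p' ?f"
  proof (rule insert.IH)
    show "f (insert i S) \<le> f (insert i T)" if "S \<subseteq> T" "T \<subseteq> I" for S T
      using that by (intro insert.prems(2)) auto
  qed (use insert.prems in auto)
  have g: "?E p f \<le> ?E p' f"
  proof (rule insert.IH)
    show "f S \<le> f T" if "S \<subseteq> T" "T \<subseteq> I" for S T
      using that by (intro insert.prems(2)) auto
  qed (use insert.prems in auto)
  have fg: "?E p' f \<le> ?E p' ?f"
  proof (rule subset_expectation_mono_fun)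
    show "p' j \<in> {0..1}" if "j \<in> I" for j
      using insert.prems(1)[of j] that by auto
    show "f S \<le> f (insert i S)" if "S \<subseteq> I" for S
      using insert.prems that by blast
  qed
  have pi: "0 \<le> p i" "p i \<le> p' i" "p' i \<le> 1"
    using insert.prems(1)[of i] by auto
  have "p i * ?E p ?f + (1 - p i) * ?E p f \<le> p i * ?E p' ?f + (1 - p i) * ?E p' f"
    using f g pi by (intro add_mono mult_left_mono) auto
  \<comment> \<open>Regrouped as an affine function of \<open>p i\<close>; its slope, the gain from
    selecting \<open>i\<close>, is nonnegative by \<open>fg\<close>.\<close>
  also have "\<dots> = ?E p' f + p i * (?E p' ?f - ?E p' f)"
    by (simp add: algebra_simps)
  also have "\<dots> \<le> ?E p' f + p' i * (?E p' ?f - ?E p' f)"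
    using fg pi by (intro add_left_mono mult_right_mono) auto
  also have "\<dots> = p' i * ?E p' ?f + (1 - p' i) * ?E p' f"
    by (simp add: algebra_simps)
  finally show ?case
    using insert.hyps by (simp add: subset_expectation_insert)
qed

section \<open>Sublevel events of samples and the weighted ERM action\<close>

text \<open>Partition by the exact set \<open>S\<close> of coordinates that are at most
  \<open>t\<close>: each cell is a box, whose probability is a product of values
  \<open>cdf (F i) t\<close> and their complements.\<close>

lemma measure_PiM_sublevel_set:
  fixes F :: "'i \<Rightarrow> real measure"
  assumes "finite I" and F: "\<And>i. real_distribution (F i)"
  shows "measure (Pi\<^sub>M I F) {y \<in> space (Pi\<^sub>M I F). P {i \<in> I. y i \<le> t}} =
    subset_expectation I (\<lambda>i. cdf (F i) t) (\<lambda>S. of_bool (P S))"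
proof -
  interpret F: real_distribution "F i" for i
    by (rule F)
  interpret finite_product_prob_space F I
    by unfold_locales fact
  let ?A = "\<lambda>S i. if i \<in> S then {..t} else {t<..}"
  let ?B = "\<lambda>S. Pi\<^sub>E I (?A S)"
  let ?C = "{S \<in> Pow I. P S}"
  have B: "?B S = {y \<in> space (Pi\<^sub>M I F). {i \<in> I. y i \<le> t} = S}" if "S \<subseteq> I" for S
    using that by (auto simp: space_PiM PiE_def Pi_def not_le split: if_splits)
  have "{y \<in> space (Pi\<^sub>M I F). P {i \<in> I. y i \<le> t}} = (\<Union>S\<in>?C. ?B S)"
    using B by auto
  also have "measure (Pi\<^sub>M I F) \<dots> = (\<Sum>S\<in>?C. measure (Pi\<^sub>M I F) (?B S))"
  proof (rule finite_measure_finite_Union)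
    show "finite ?C"
      using \<open>finite I\<close> by simp
    show "(\<lambda>S. ?B S) ` ?C \<subseteq> sets (Pi\<^sub>M I F)"
      using \<open>finite I\<close> by (auto intro!: sets_PiM_I_finite)
    show "disjoint_family_on ?B ?C"
      using B by (auto simp: disjoint_family_on_def)
  qed
  also have "\<dots> = (\<Sum>S\<in>?C. \<Prod>i\<in>I. if i \<in> S then cdf (F i) t else 1 - cdf (F i) t)"
  proof (intro sum.cong refl)
    fix S
    have compl: "measure (F i) {t<..} = 1 - cdf (F i) t" for i
    proof -
      have "{t<..} = space (F i) - {..t}"
        by auto
      then show ?thesis
        by (simp add: F.prob_compl cdf_def del: F.space_eq_univ)
    qed
    show "measure (Pi\<^sub>M I F) (?B S) = (\<Prod>i\<in>I. if i \<in> S then cdf (F i) t else 1 - cdf (F i) t)"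
      by (subst finite_measure_PiM_emb) (auto simp: compl cdf_def intro!: prod.cong)
  qed
  also have "\<dots> = subset_expectation I (\<lambda>i. cdf (F i) t) (\<lambda>S. of_bool (P S))"
    unfolding subset_expectation_def using \<open>finite I\<close>
    by (intro sum.mono_neutral_cong_left) auto
  finally show ?thesis .
qed

text \<open>The normalised weight of the samples at most \<open>a\<close> is a right-continuous step
  function of \<open>a\<close>, equal to 0 strictly below all samples and to 1 at the largest one,
  so \<open>Inf_superlevel_le_iff\<close> applies. The costs are written as \<open>1 - q\<close> and
  \<open>q\<close>, for which the critical ratio is \<open>q\<close> itself.\<close>

lemma weighted_erm_le_iff:
  assumes "0 < q" "q < 1" and w: "\<And>i. i \<in> {1..n} \<Longrightarrow> 0 \<le> w x i" and W: "0 < (\<Sum>j = 1..n. w x j)"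
  shows "weighted_erm (1 - q) q n w x y \<le> t \<longleftrightarrow>
    q * (\<Sum>j = 1..n. w x j) \<le> (\<Sum>i | i \<in> {1..n} \<and> y i \<le> t. w x i)"
proof -
  let ?W = "\<Sum>j = 1..n. w x j"
  let ?g = "\<lambda>a. (\<Sum>i = 1..n. w x i * of_bool (y i \<le> a)) / ?W"
  have g: "?g a = (\<Sum>i | i \<in> {1..n} \<and> y i \<le> a. w x i) / ?W" for a
    by (simp add: of_bool_def if_distrib sum.inter_filter[symmetric] cong: if_cong)
  have "mono ?g"
    using w W by (intro monoI divide_right_mono sum_mono mult_left_mono) auto
  moreover have "continuous (at_right t) ?g"
    using W by (intro continuous_divide continuous_sum continuous_mult continuous_const
        continuous_at_right_of_bool_le) auto
  moreover have "{a. q \<le> ?g a} \<noteq> {}"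
  proof -
    have "y i \<le> Max (y ` {1..n})" if "i \<in> {1..n}" for i
      using that by (intro Max_ge) auto
    then have "?g (Max (y ` {1..n})) = ?W / ?W"
      by (intro arg_cong2[where f="(/)"] sum.cong) auto
    then have "q \<le> ?g (Max (y ` {1..n}))"
      using assms(2) W by simp
    then show ?thesis
      by blast
  qed
  moreover have "bdd_below {a. q \<le> ?g a}"
  proof (rule bdd_belowI)
    fix a assume a: "a \<in> {a. q \<le> ?g a}"
    show "Min (y ` {1..n}) \<le> a"
    proof (rule ccontr)
      assume "\<not> ?thesis"
      moreover have "Min (y ` {1..n}) \<le> y i" if "i \<in> {1..n}" for i
        using that by (intro Min_le) auto
      ultimately have "a < y i" if "i \<in> {1..n}" for i
        using that by (meson not_le order_trans)
      then have "(\<Sum>i = 1..n. w x i * of_bool (y i \<le> a)) = 0"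
        by (intro sum.neutral) (auto simp: not_le)
      then show False
        using a \<open>0 < q\<close> by simp
    qed
  qed
  ultimately have "Inf {a. q \<le> ?g a} \<le> t \<longleftrightarrow> q \<le> ?g t"
    by (rule Inf_superlevel_le_iff)
  then show ?thesis
    using W unfolding weighted_erm_def critical_ratio_def g by (simp add: pos_le_divide_eq)
qed

section \<open>Distributions on the unit interval and their optimal action\<close>

lemma unit_dists_cdf:
  assumes "F \<in> unit_dists"
  shows "t < 0 \<Longrightarrow> cdf F t = 0" "1 \<le> t \<Longrightarrow> cdf F t = 1"
    "0 \<le> cdf F t" "cdf F t \<le> 1" "mono (cdf F)" "continuous (at_right t) (cdf F)"
    "AE y in F. 0 \<le> y \<and> y \<le> 1" "real_distribution F"
proof -
  show F: "real_distribution F"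
    using assms by (simp add: unit_dists_def)
  then interpret real_distribution F .
  show ae: "AE y in F. 0 \<le> y \<and> y \<le> 1"
    using assms prob_eq_1[of "{0..1}"] by (simp add: unit_dists_def)
  show "cdf F t = 0" if "t < 0"
    unfolding cdf_def using that by (subst prob_eq_0) (auto intro: AE_mp[OF ae])
  show "cdf F t = 1" if "1 \<le> t"
    unfolding cdf_def using that by (subst prob_eq_1) (auto intro: AE_mp[OF ae])
  show "0 \<le> cdf F t" "cdf F t \<le> 1" "continuous (at_right t) (cdf F)"
    by (auto simp: cdf_nonneg cdf_bounded_prob cdf_is_right_cont)
  show "mono (cdf F)"
    by (auto intro: monoI cdf_nondecreasing)
qed

text \<open>The infimum in \<open>opt_action\<close> ranges over [0,1] only. Dropping this
  restriction does not change it, since \<open>cdf F\<close> vanishes left of 0 and equals 1 at 1;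
  then \<open>Inf_superlevel_le_iff\<close> applies.\<close>

lemma opt_action_unit_dists:
  assumes F: "F \<in> unit_dists" and q: "0 < q" "q < 1"
  shows "opt_action (1 - q) q F \<in> {0..1}" "opt_action (1 - q) q F \<le> t \<longleftrightarrow> q \<le> cdf F t"
proof -
  note cdf = unit_dists_cdf[OF F]
  let ?A = "{a. q \<le> cdf F a}"
  have A: "0 \<le> a" if "a \<in> ?A" for a
    using that cdf(1)[of a] q by force
  then have bdd: "bdd_below ?A"
    by (intro bdd_belowI[of _ 0])
  have 1: "1 \<in> ?A"
    using cdf(2)[of 1] q by simp
  have "Inf {a \<in> {0..1}. q \<le> cdf F a} = Inf ?A"
  proof (rule antisym)
    show "Inf {a \<in> {0..1}. q \<le> cdf F a} \<le> Inf ?A"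
    proof (rule cInf_greatest)
      fix a assume a: "a \<in> ?A"
      \<comment> \<open>Truncating at 1 keeps the point admissible, because
        \<open>cdf F 1 = 1\<close> is at least \<open>q\<close>.\<close>
      have "Inf {a \<in> {0..1}. q \<le> cdf F a} \<le> min a 1"
        using a A[OF a] 1 by (intro cInf_lower bdd_belowI[of _ 0]) (auto simp: min_def)
      then show "Inf {a \<in> {0..1}. q \<le> cdf F a} \<le> a"
        by simp
    qed (use 1 in blast)
    show "Inf ?A \<le> Inf {a \<in> {0..1}. q \<le> cdf F a}"
      using 1 bdd by (intro cInf_superset_mono) auto
  qed
  then have eq: "opt_action (1 - q) q F = Inf ?A"
    by (simp add: opt_action_def critical_ratio_def)
  show "opt_action (1 - q) q F \<le> t \<longleftrightarrow> q \<le> cdf F t"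
    unfolding eq using 1 bdd by (intro Inf_superlevel_le_iff cdf) blast+
  show "opt_action (1 - q) q F \<in> {0..1}"
    unfolding eq using A bdd 1 by (auto intro!: cInf_greatest cInf_lower)
qed

section \<open>Loss and regret as integrals over thresholds\<close>

text \<open>The interval is half-open because every Bernoulli cdf is constant on it but may jump at
  1. As a probability measure it integrates constants to themselves.\<close>

abbreviation unif01 :: "real measure" where
  "unif01 \<equiv> uniform_measure lborel {0..<1}"

lemma prob_space_unif01: "prob_space unif01"
  by (rule prob_space_uniform_measure) auto

lemma AE_unif01: "AE t in unif01. 0 \<le> t \<and> t < 1"
  by (rule AE_uniform_measureI) auto

lemma measure_unif01_atLeastLessThan:
  assumes "y \<in> {0..1}" "a \<in> {0..1}"
  shows "measure unif01 {y..<a} = max 0 (a - y)"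
proof -
  have "{0..<1} \<inter> {y..<a} = {y..<a}"
    using assms by auto
  then show ?thesis
    by (cases "y \<le> a") (simp_all add: measure_uniform_measure)
qed

text \<open>Used twice: with \<open>Z\<close> the demand it turns the expected overage into an
  integral of the cdf, and with \<open>Z\<close> the ERM action as a function of the sample it
  brings the law of the action into the expected regret. Boundedness of \<open>g\<close> gives
  integrability on the product.\<close>

lemma Fubini_le:
  fixes g :: "real \<Rightarrow> real"
  assumes "prob_space M" and [measurable]: "Z \<in> borel_measurable M"
    and [measurable]: "g \<in> borel_measurable borel" and g: "\<And>t. \<bar>g t\<bar> \<le> B"
  shows "integrable M (\<lambda>\<omega>. \<integral>t. g t * of_bool (Z \<omega> \<le> t) \<partial>unif01)"
    and "(\<integral>\<omega>. (\<integral>t. g t * of_bool (Z \<omega> \<le> t) \<partial>unif01) \<partial>M) =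
      (\<integral>t. g t * measure M {\<omega> \<in> space M. Z \<omega> \<le> t} \<partial>unif01)"
proof -
  interpret M: prob_space M by fact
  interpret U: prob_space unif01 by (rule prob_space_unif01)
  interpret P: pair_prob_space M unif01 ..
  have int: "integrable (M \<Otimes>\<^sub>M unif01) (\<lambda>(\<omega>, t). g t * of_bool (Z \<omega> \<le> t))"
  proof (rule P.integrable_const_bound[of _ B])
    show "AE z in M \<Otimes>\<^sub>M unif01. norm (case z of (\<omega>, t) \<Rightarrow> g t * of_bool (Z \<omega> \<le> t)) \<le> B"
    proof (rule AE_I2, safe)
      fix \<omega> t
      show "norm (g t * of_bool (Z \<omega> \<le> t)) \<le> B"
        using g[of t] by (auto simp: of_bool_def)
    qed
  qed measurable
  show "integrable M (\<lambda>\<omega>. \<integral>t. g t * of_bool (Z \<omega> \<le> t) \<partial>unif01)"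
    using P.integrable_fst'[OF int] by simp
  have "(\<integral>\<omega>. of_bool (Z \<omega> \<le> t) \<partial>M) = measure M {\<omega> \<in> space M. Z \<omega> \<le> t}" for t
  proof -
    have "(\<integral>\<omega>. of_bool (Z \<omega> \<le> t) \<partial>M) = (\<integral>\<omega>. indicator {\<omega> \<in> space M. Z \<omega> \<le> t} \<omega> \<partial>M :: real)"
      by (intro Bochner_Integration.integral_cong) auto
    also have "\<dots> = measure M ({\<omega> \<in> space M. Z \<omega> \<le> t} \<inter> space M)"
      by (rule Bochner_Integration.integral_indicator)
    also have "{\<omega> \<in> space M. Z \<omega> \<le> t} \<inter> space M = {\<omega> \<in> space M. Z \<omega> \<le> t}"
      by auto
    finally show ?thesis .
  qed
  then show "(\<integral>\<omega>. (\<integral>t. g t * of_bool (Z \<omega> \<le> t) \<partial>unif01) \<partial>M) =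
      (\<integral>t. g t * measure M {\<omega> \<in> space M. Z \<omega> \<le> t} \<partial>unif01)"
    using P.Fubini_integral[OF int] by simp
qed

lemma borel_measurable_cdf:
  assumes "F \<in> unit_dists"
  shows "cdf F \<in> borel_measurable borel"
  using unit_dists_cdf(5)[OF assms] by (rule borel_measurable_mono)

text \<open>As the costs add up to 1, the loss is \<open>q * (y - a) + max 0 (a - y)\<close>. The
  overage is the length of the set of all \<open>t\<close> with \<open>y \<le> t < a\<close>, and
  averaging its indicator over \<open>y\<close> leaves \<open>cdf F t\<close>.\<close>

lemma expected_loss_unit_dists:
  assumes F: "F \<in> unit_dists" and a: "a \<in> {0..1}"
  shows "expected_loss (1 - q) q a F =
    q * (\<integral>y. y \<partial>F) - q * a + (\<integral>t. of_bool (t < a) * cdf F t \<partial>unif01)"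
proof -
  note cdf = unit_dists_cdf[OF F]
  interpret real_distribution F by (rule cdf)
  let ?h = "\<lambda>y. \<integral>t. of_bool (t < a) * of_bool (y \<le> t) \<partial>unif01 :: real"
  have meas: "id \<in> borel_measurable F"
    by simp
  have h: "?h y = max 0 (a - y)" if "0 \<le> y" "y \<le> 1" for y
  proof -
    have "?h y = (\<integral>t. indicator {y..<a} t \<partial>unif01)"
      by (intro Bochner_Integration.integral_cong) (auto simp: indicator_def)
    then show ?thesis
      using measure_unif01_atLeastLessThan[of y a] that a by simp
  qed
  have int_h: "integrable F ?h"
    using Fubini_le(1)[OF prob_space_axioms meas, of "\<lambda>t. of_bool (t < a)" 1] by simp
  have int_id: "integrable F (\<lambda>y. y)"
    by (rule integrable_const_bound[of _ 1]) (use cdf(7) in auto)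
  have "expected_loss (1 - q) q a F = (\<integral>y. q * y - q * a + ?h y \<partial>F)"
    unfolding expected_loss_def
  proof (rule integral_cong_AE)
    show "AE y in F. newsvendor_loss (1 - q) q a y = q * y - q * a + ?h y"
      using cdf(7) by (rule AE_mp) (auto simp: h newsvendor_loss_def max_def algebra_simps)
    show "newsvendor_loss (1 - q) q a \<in> borel_measurable F"
      unfolding newsvendor_loss_def by simp
  qed (use int_h in auto)
  also have "\<dots> = q * (\<integral>y. y \<partial>F) - q * a + (\<integral>y. ?h y \<partial>F)"
    using int_h int_id prob_space by simp
  also have "(\<integral>y. ?h y \<partial>F) = (\<integral>t. of_bool (t < a) * cdf F t \<partial>unif01)"
    using Fubini_le(2)[OF prob_space_axioms meas, of "\<lambda>t. of_bool (t < a)" 1]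
    by (simp add: cdf_def atMost_def)
  finally show ?thesis .
qed

lemma integrable_unif01_bounded:
  fixes f :: "real \<Rightarrow> real"
  assumes "f \<in> borel_measurable borel" "\<And>t. \<bar>f t\<bar> \<le> B"
  shows "integrable unif01 f"
proof -
  interpret U: prob_space unif01 by (rule prob_space_unif01)
  show ?thesis
    by (rule U.integrable_const_bound[of _ B]) (use assms in auto)
qed

text \<open>Up to a term independent of \<open>a\<close>, the loss is minus the integral of
  \<open>cdf F t - q\<close> over the thresholds \<open>t\<close> with \<open>a \<le> t\<close>.
  That term cancels in the difference, and for the optimal action the condition on \<open>t\<close>
  becomes \<open>q \<le> cdf F t\<close>.\<close>

lemma regret_unit_dists:
  assumes F: "F \<in> unit_dists" and a: "a \<in> {0..1}" and q: "0 < q" "q < 1"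
  shows "regret (1 - q) q a F =
    (\<integral>t. of_bool (q \<le> cdf F t) * (cdf F t - q) \<partial>unif01) -
    (\<integral>t. (cdf F t - q) * of_bool (a \<le> t) \<partial>unif01)"
proof -
  note cdf = unit_dists_cdf[OF F]
  note [measurable] = borel_measurable_cdf[OF F]
  note opt = opt_action_unit_dists[OF F q]
  interpret U: prob_space unif01 by (rule prob_space_unif01)
  have b1: "\<bar>cdf F t\<bar> \<le> 1" for t
    using cdf(3,4)[of t] by auto
  have int_F: "integrable unif01 (cdf F)"
    using b1 by (intro integrable_unif01_bounded[of _ 1]) auto
  have int1: "integrable unif01 (\<lambda>t. of_bool (t < b) * cdf F t)" for b
    using b1 by (intro integrable_unif01_bounded[of _ 1]) (auto simp: of_bool_def)
  have int2: "integrable unif01 (\<lambda>t. (cdf F t - q) * of_bool (b \<le> t))" for b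
  proof (rule integrable_unif01_bounded[of _ 1])
    show "\<bar>(cdf F t - q) * of_bool (b \<le> t)\<bar> \<le> 1" for t
      using cdf(3,4)[of t] q by (auto simp: of_bool_def)
  qed measurable
  have loss: "expected_loss (1 - q) q b F = q * (\<integral>y. y \<partial>F) +
      ((\<integral>t. cdf F t - q \<partial>unif01) - (\<integral>t. (cdf F t - q) * of_bool (b \<le> t) \<partial>unif01))"
    if b: "b \<in> {0..1}" for b
  proof -
    have "integrable unif01 (indicator {0..<b} :: real \<Rightarrow> real)"
      by (intro integrable_unif01_bounded[of _ 1]) auto
    moreover have "measure unif01 {0..<b} = b"
      using b measure_unif01_atLeastLessThan[of 0 b] by simp
    \<comment> \<open>Since \<open>b\<close> is the length of [0,b), the linear term becomes an
      integral over thresholds too.\<close>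
    ultimately have "- q * b + (\<integral>t. of_bool (t < b) * cdf F t \<partial>unif01) =
        (\<integral>t. - q * indicator {0..<b} t + of_bool (t < b) * cdf F t \<partial>unif01)"
      using int1[of b] by simp
    also have "\<dots> = (\<integral>t. (cdf F t - q) - (cdf F t - q) * of_bool (b \<le> t) \<partial>unif01)"
    proof (rule integral_cong_AE)
      show "AE t in unif01. - q * indicator {0..<b} t + of_bool (t < b) * cdf F t =
          (cdf F t - q) - (cdf F t - q) * of_bool (b \<le> t)"
        using AE_unif01 by (rule AE_mp) (auto simp: of_bool_def indicator_def)
    qed auto
    also have "\<dots> = (\<integral>t. cdf F t - q \<partial>unif01) - (\<integral>t. (cdf F t - q) * of_bool (b \<le> t) \<partial>unif01)"
      using int_F int2[of b] by (subst Bochner_Integration.integral_diff) auto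
    finally show ?thesis
      using expected_loss_unit_dists[OF F b, of q] by simp
  qed
  show ?thesis
    unfolding regret_def loss[OF a] loss[OF opt(1)] by (simp add: opt(2) mult.commute)
qed

section \<open>The expected regret of weighted ERM\<close>

lemma prob_weighted_erm_le:
  assumes q: "0 < q" "q < 1" and w: "\<And>i. i \<in> {1..n} \<Longrightarrow> 0 \<le> w x i"
    and W: "0 < (\<Sum>j = 1..n. w x j)" and F: "\<And>i. real_distribution (F i)"
  shows "measure (Pi\<^sub>M {1..n} F) {y \<in> space (Pi\<^sub>M {1..n} F). weighted_erm (1 - q) q n w x y \<le> t} =
    subset_expectation {1..n} (\<lambda>i. cdf (F i) t)
      (\<lambda>S. of_bool (q * (\<Sum>j = 1..n. w x j) \<le> (\<Sum>i\<in>S. w x i)))"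
proof -
  have "weighted_erm (1 - q) q n w x y \<le> t \<longleftrightarrow>
      q * (\<Sum>j = 1..n. w x j) \<le> (\<Sum>i | i \<in> {1..n} \<and> y i \<le> t. w x i)" for y
    by (rule weighted_erm_le_iff[of q n w x, OF q w W])
  then show ?thesis
    using measure_PiM_sublevel_set[of "{1..n}" F "\<lambda>S. q * (\<Sum>j = 1..n. w x j) \<le> (\<Sum>i\<in>S. w x i)" t, OF _ F]
    by simp
qed

text \<open>By \<open>weighted_erm_le_iff\<close> the sublevel sets are conditions on a finite
  weighted sum of indicators, so the infimum itself needs no treatment.\<close>

lemma borel_measurable_weighted_erm:
  assumes q: "0 < q" "q < 1" and w: "\<And>i. i \<in> {1..n} \<Longrightarrow> 0 \<le> w x i"
    and W: "0 < (\<Sum>j = 1..n. w x j)" and F: "\<And>i. sets (F i) = sets borel"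
  shows "weighted_erm (1 - q) q n w x \<in> borel_measurable (Pi\<^sub>M {1..n} F)"
proof -
  have [measurable]: "(\<lambda>y. y i) \<in> borel_measurable (Pi\<^sub>M {1..n} F)" if "i \<in> {1..n}" for i
    using measurable_component_singleton[OF that, of F] F[of i] by (simp cong: measurable_cong_sets)
  have eq: "(\<Sum>i | i \<in> {1..n} \<and> y i \<le> t. w x i) = (\<Sum>i\<in>{1..n}. w x i * of_bool (y i \<le> t))" for y t
    by (simp add: of_bool_def if_distrib sum.inter_filter[symmetric] cong: if_cong)
  show ?thesis
    unfolding borel_measurable_iff_le
  proof
    fix t
    have "weighted_erm (1 - q) q n w x y \<le> t \<longleftrightarrow>
        q * (\<Sum>j = 1..n. w x j) \<le> (\<Sum>i\<in>{1..n}. w x i * of_bool (y i \<le> t))" for y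
      unfolding eq[symmetric] by (rule weighted_erm_le_iff[of q n w x, OF q w W])
    moreover have "{y \<in> space (Pi\<^sub>M {1..n} F). q * (\<Sum>j = 1..n. w x j) \<le>
        (\<Sum>i\<in>{1..n}. w x i * of_bool (y i \<le> t))} \<in> sets (Pi\<^sub>M {1..n} F)"
      by measurable
    ultimately show "{y \<in> space (Pi\<^sub>M {1..n} F). weighted_erm (1 - q) q n w x y \<le> t} \<in> sets (Pi\<^sub>M {1..n} F)"
      by presburger
  qed
qed

text \<open>The contribution of one threshold \<open>t\<close> to the expected regret:
  \<open>p\<^sub>0\<close> and \<open>p i\<close> stand for the values at \<open>t\<close> of the
  true cdf and the sample cdfs, \<open>v\<close> for the weights, and the subset expectation is the
  probability that the ERM action is at most \<open>t\<close>.\<close>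

definition erm_regret_density :: "real \<Rightarrow> nat \<Rightarrow> (nat \<Rightarrow> real) \<Rightarrow> real \<Rightarrow> (nat \<Rightarrow> real) \<Rightarrow> real" where
  "erm_regret_density q n v p\<^sub>0 p = (p\<^sub>0 - q) * (of_bool (q \<le> p\<^sub>0) -
     subset_expectation {1..n} p (\<lambda>S. of_bool (q * (\<Sum>j = 1..n. v j) \<le> (\<Sum>i\<in>S. v i))))"

text \<open>Average the threshold formula of \<open>regret_unit_dists\<close> over the sample and
  exchange the integrals. At each \<open>t\<close> the sample then enters only through the event
  that the action is at most \<open>t\<close>, whose probability is given by
  \<open>prob_weighted_erm_le\<close>.\<close>

lemma expected_regret_eq:
  assumes q: "0 < q" "q < 1" and w: "\<And>i. i \<in> {1..n} \<Longrightarrow> 0 \<le> w x i"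
    and W: "0 < (\<Sum>j = 1..n. w x j)"
    and F\<^sub>0: "F\<^sub>0 \<in> unit_dists" and F: "\<And>i. i \<in> {1..n} \<Longrightarrow> F i \<in> unit_dists"
  shows "expected_regret (1 - q) q n (weighted_erm (1 - q) q n w) x F\<^sub>0 F =
    (\<integral>t. erm_regret_density q n (w x) (cdf F\<^sub>0 t) (\<lambda>i. cdf (F i) t) \<partial>unif01)"
    and "integrable unif01 (\<lambda>t. erm_regret_density q n (w x) (cdf F\<^sub>0 t) (\<lambda>i. cdf (F i) t))"
proof -
  \<comment> \<open>Only the components in \<open>{1..n}\<close> are constrained, while the
    product-space facts expect a distribution at every index; padding with \<open>F\<^sub>0\<close>
    leaves the product over \<open>{1..n}\<close> unchanged.\<close>
  define G where "G i = (if i \<in> {1..n} then F i else F\<^sub>0)" for i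
  have G: "G i \<in> unit_dists" for i
    using F\<^sub>0 F by (simp add: G_def)
  interpret G: real_distribution "G i" for i
    by (rule unit_dists_cdf[OF G])
  let ?M = "Pi\<^sub>M {1..n} G"
  let ?\<pi> = "weighted_erm (1 - q) q n w x"
  interpret finite_product_prob_space G "{1..n}"
    by unfold_locales simp
  note cdf = unit_dists_cdf[OF F\<^sub>0]
  note [measurable] = borel_measurable_cdf[OF F\<^sub>0] borel_measurable_cdf[OF G]
  have erm_iff: "?\<pi> y \<le> t \<longleftrightarrow> q * (\<Sum>j = 1..n. w x j) \<le> (\<Sum>i | i \<in> {1..n} \<and> y i \<le> t. w x i)" for y t
    using assms by (intro weighted_erm_le_iff) auto
  have meas [measurable]: "?\<pi> \<in> borel_measurable ?M"
    using assms by (intro borel_measurable_weighted_erm) auto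
  have "AE y in ?M. \<forall>i\<in>{1..n}. 0 \<le> y i \<and> y i \<le> 1"
    using unit_dists_cdf(7)[OF G]
    by (intro AE_finite_allI) (auto intro!: AE_PiM_component G.prob_space_axioms)
  \<comment> \<open>The regret formula needs an action in [0,1]. For samples in [0,1] all the weight
    lies at or below 1 and none below 0.\<close>
  then have erm01: "AE y in ?M. ?\<pi> y \<in> {0..1}"
  proof (rule AE_mp, intro AE_I2 impI)
    fix y :: "nat \<Rightarrow> real"
    assume y: "\<forall>i\<in>{1..n}. 0 \<le> y i \<and> y i \<le> 1"
    then have "{i \<in> {1..n}. y i \<le> 1} = {1..n}"
      by auto
    then have "?\<pi> y \<le> 1"
      unfolding erm_iff using W q by simp
    moreover have "\<not> ?\<pi> y \<le> t" if "t < 0" for t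
    proof -
      have none: "{i \<in> {1..n}. y i \<le> t} = {}"
        using y that by force
      show ?thesis
        unfolding erm_iff none using W q by (simp add: not_le)
    qed
    ultimately show "?\<pi> y \<in> {0..1}"
      by (metis atLeastAtMost_iff not_le order_refl)
  qed
  let ?H = "\<lambda>t. subset_expectation {1..n} (\<lambda>i. cdf (G i) t)
      (\<lambda>S. of_bool (q * (\<Sum>j = 1..n. w x j) \<le> (\<Sum>i\<in>S. w x i)))"
  have H: "measure ?M {y \<in> space ?M. ?\<pi> y \<le> t} = ?H t" for t
    using assms unit_dists_cdf(8)[OF G] by (intro prob_weighted_erm_le) auto
  have [measurable]: "?H \<in> borel_measurable borel"
    unfolding subset_expectation_def by measurable
  have b: "\<bar>cdf F\<^sub>0 t - q\<bar> \<le> 1" for t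
    using cdf(3,4)[of t] q by auto
  have int1: "integrable unif01 (\<lambda>t. of_bool (q \<le> cdf F\<^sub>0 t) * (cdf F\<^sub>0 t - q))"
  proof (rule integrable_unif01_bounded[of _ 1])
    show "\<bar>of_bool (q \<le> cdf F\<^sub>0 t) * (cdf F\<^sub>0 t - q)\<bar> \<le> 1" for t
      using b[of t] by (auto simp: of_bool_def)
  qed measurable
  have int2: "integrable unif01 (\<lambda>t. (cdf F\<^sub>0 t - q) * ?H t)"
  proof (rule integrable_unif01_bounded[of _ 1])
    have "0 \<le> ?H t" "?H t \<le> 1" for t
      unfolding H[symmetric] by (rule measure_nonneg, rule prob_le_1)
    then have "\<bar>cdf F\<^sub>0 t - q\<bar> * \<bar>?H t\<bar> \<le> 1 * 1" for t
      using b by (intro mult_mono) simp_all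
    then show "\<bar>(cdf F\<^sub>0 t - q) * ?H t\<bar> \<le> 1" for t
      by (simp add: abs_mult)
  qed measurable
  \<comment> \<open>A split into a part from the optimal action, which does not depend on the
    sample, and a part carrying the law of the ERM action.\<close>
  have dens: "erm_regret_density q n (w x) (cdf F\<^sub>0 t) (\<lambda>i. cdf (F i) t) =
      of_bool (q \<le> cdf F\<^sub>0 t) * (cdf F\<^sub>0 t - q) - (cdf F\<^sub>0 t - q) * ?H t" for t
  proof -
    have "subset_expectation {1..n} (\<lambda>i. cdf (F i) t) = subset_expectation {1..n} (\<lambda>i. cdf (G i) t)"
      by (intro ext subset_expectation_cong) (auto simp: G_def)
    then show ?thesis
      by (simp add: erm_regret_density_def algebra_simps)
  qed
  show "integrable unif01 (\<lambda>t. erm_regret_density q n (w x) (cdf F\<^sub>0 t) (\<lambda>i. cdf (F i) t))"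
    unfolding dens using int1 int2 by (rule Bochner_Integration.integrable_diff)
  have "Pi\<^sub>M {1..n} F = ?M"
    by (intro PiM_cong) (auto simp: G_def)
  then have "expected_regret (1 - q) q n (weighted_erm (1 - q) q n w) x F\<^sub>0 F =
      (\<integral>y. regret (1 - q) q (?\<pi> y) F\<^sub>0 \<partial>?M)"
    by (simp add: expected_regret_def)
  also have "\<dots> = (\<integral>y. (\<integral>t. of_bool (q \<le> cdf F\<^sub>0 t) * (cdf F\<^sub>0 t - q) \<partial>unif01) -
      (\<integral>t. (cdf F\<^sub>0 t - q) * of_bool (?\<pi> y \<le> t) \<partial>unif01) \<partial>?M)"
  proof (rule integral_cong_AE)
    show "(\<lambda>y. regret (1 - q) q (?\<pi> y) F\<^sub>0) \<in> borel_measurable ?M"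
    proof -
      interpret F\<^sub>0: real_distribution F\<^sub>0 by (rule cdf)
      show ?thesis
        unfolding regret_def expected_loss_def newsvendor_loss_def by measurable
    qed
    show "AE y in ?M. regret (1 - q) q (?\<pi> y) F\<^sub>0 =
        (\<integral>t. of_bool (q \<le> cdf F\<^sub>0 t) * (cdf F\<^sub>0 t - q) \<partial>unif01) -
        (\<integral>t. (cdf F\<^sub>0 t - q) * of_bool (?\<pi> y \<le> t) \<partial>unif01)"
      using erm01 by (rule AE_mp) (auto intro!: AE_I2 regret_unit_dists F\<^sub>0 q)
    have "integrable ?M (\<lambda>y. \<integral>t. (cdf F\<^sub>0 t - q) * of_bool (?\<pi> y \<le> t) \<partial>unif01)"
      using Fubini_le(1)[of ?M ?\<pi> "\<lambda>t. cdf F\<^sub>0 t - q" 1, OF prob_space_axioms meas] b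
      by simp
    then show "(\<lambda>y. (\<integral>t. of_bool (q \<le> cdf F\<^sub>0 t) * (cdf F\<^sub>0 t - q) \<partial>unif01) -
        (\<integral>t. (cdf F\<^sub>0 t - q) * of_bool (?\<pi> y \<le> t) \<partial>unif01)) \<in> borel_measurable ?M"
      by (intro borel_measurable_diff) auto
  qed
  also have "\<dots> = (\<integral>y. (\<integral>t. of_bool (q \<le> cdf F\<^sub>0 t) * (cdf F\<^sub>0 t - q) \<partial>unif01) \<partial>?M) -
      (\<integral>y. (\<integral>t. (cdf F\<^sub>0 t - q) * of_bool (?\<pi> y \<le> t) \<partial>unif01) \<partial>?M)"
    using b by (intro Bochner_Integration.integral_diff integrable_const
        Fubini_le(1)[OF prob_space_axioms meas, of _ 1]) auto
  also have "(\<integral>y. (\<integral>t. of_bool (q \<le> cdf F\<^sub>0 t) * (cdf F\<^sub>0 t - q) \<partial>unif01) \<partial>?M) =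
      (\<integral>t. of_bool (q \<le> cdf F\<^sub>0 t) * (cdf F\<^sub>0 t - q) \<partial>unif01)"
    using prob_space.prob_space[OF prob_space_axioms] by simp
  also have "(\<integral>y. (\<integral>t. (cdf F\<^sub>0 t - q) * of_bool (?\<pi> y \<le> t) \<partial>unif01) \<partial>?M) =
      (\<integral>t. (cdf F\<^sub>0 t - q) * ?H t \<partial>unif01)"
    using Fubini_le(2)[of ?M ?\<pi> "\<lambda>t. cdf F\<^sub>0 t - q" 1, OF prob_space_axioms meas] b
    unfolding H[symmetric] by simp
  also have "(\<integral>t. of_bool (q \<le> cdf F\<^sub>0 t) * (cdf F\<^sub>0 t - q) \<partial>unif01) - \<dots> =
      (\<integral>t. erm_regret_density q n (w x) (cdf F\<^sub>0 t) (\<lambda>i. cdf (F i) t) \<partial>unif01)"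
    unfolding dens using int1 int2 by (rule Bochner_Integration.integral_diff[symmetric])
  finally show "expected_regret (1 - q) q n (weighted_erm (1 - q) q n w) x F\<^sub>0 F =
    (\<integral>t. erm_regret_density q n (w x) (cdf F\<^sub>0 t) (\<lambda>i. cdf (F i) t) \<partial>unif01)" .
qed

section \<open>Bounds and monotonicity at a fixed threshold\<close>

text \<open>Both factors are at most 1 in absolute value. The bound serves to show that the real
  suprema are over sets bounded above.\<close>

lemma erm_regret_density_le_one:
  assumes "0 < q" "q < 1" "p\<^sub>0 \<in> {0..1}" "\<And>i. i \<in> {1..n} \<Longrightarrow> p i \<in> {0..1}"
  shows "erm_regret_density q n v p\<^sub>0 p \<le> 1"
proof -
  let ?f = "\<lambda>S. of_bool (q * (\<Sum>j = 1..n. v j) \<le> (\<Sum>i\<in>S. v i)) :: real"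
  let ?H = "subset_expectation {1..n} p ?f"
  have "subset_expectation {1..n} p (\<lambda>_. 0) \<le> ?H" "?H \<le> subset_expectation {1..n} p (\<lambda>_. 1)"
    using assms by (auto intro!: subset_expectation_mono_fun)
  then have "0 \<le> ?H" "?H \<le> 1"
    by (simp_all add: subset_expectation_const)
  then have "\<bar>p\<^sub>0 - q\<bar> * \<bar>of_bool (q \<le> p\<^sub>0) - ?H\<bar> \<le> 1 * 1"
    using assms by (intro mult_mono) (auto simp: of_bool_def)
  then show ?thesis
    by (simp add: erm_regret_density_def abs_mult[symmetric])
qed

text \<open>With nonnegative weights, reaching the fraction \<open>q\<close> is an increasing
  property of the selected set, so its probability increases with every \<open>p i\<close>; the sign
  of \<open>p\<^sub>0 - q\<close> decides the direction.\<close>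

lemma erm_regret_density_mono:
  assumes v: "\<And>i. i \<in> {1..n} \<Longrightarrow> 0 \<le> v i"
    and p: "\<And>i. i \<in> {1..n} \<Longrightarrow> 0 \<le> p i \<and> p i \<le> p' i \<and> p' i \<le> 1"
  shows "q \<le> p\<^sub>0 \<Longrightarrow> erm_regret_density q n v p\<^sub>0 p' \<le> erm_regret_density q n v p\<^sub>0 p"
    and "p\<^sub>0 \<le> q \<Longrightarrow> erm_regret_density q n v p\<^sub>0 p \<le> erm_regret_density q n v p\<^sub>0 p'"
proof -
  let ?f = "\<lambda>S. of_bool (q * (\<Sum>j = 1..n. v j) \<le> (\<Sum>i\<in>S. v i)) :: real"
  have "subset_expectation {1..n} p ?f \<le> subset_expectation {1..n} p' ?f"
  proof (rule subset_expectation_mono)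
    fix S T assume "S \<subseteq> T" "T \<subseteq> {1..n}"
    then have "sum v S \<le> sum v T"
      using v by (intro sum_mono2) (auto intro: finite_subset)
    then show "?f S \<le> ?f T"
      by (auto simp: of_bool_def)
  qed (use p in auto)
  then show "q \<le> p\<^sub>0 \<Longrightarrow> erm_regret_density q n v p\<^sub>0 p' \<le> erm_regret_density q n v p\<^sub>0 p"
    and "p\<^sub>0 \<le> q \<Longrightarrow> erm_regret_density q n v p\<^sub>0 p \<le> erm_regret_density q n v p\<^sub>0 p'"
    unfolding erm_regret_density_def
    by (simp_all only: mult_left_mono mult_left_mono_neg diff_left_mono diff_ge_0_iff_ge diff_le_0_iff_le)
qed

section \<open>Bernoulli distributions and the Kolmogorov distance\<close>

lemma cdf_bernoulli_dist:
  "cdf (bernoulli_dist \<mu>) t = (if t < 0 then 0 else if t < 1 then 1 - min (max \<mu> 0) 1 else 1)"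
proof -
  let ?p = "min (max \<mu> 0) 1"
  let ?A = "{b. of_bool b \<le> t}"
  have "cdf (bernoulli_dist \<mu>) t = measure (measure_pmf (bernoulli_pmf ?p)) ?A"
    by (simp add: cdf_def bernoulli_dist_def measure_distr vimage_def)
  moreover have "?A = (if t < 0 then {} else if t < 1 then {False} else UNIV)"
    by (auto simp: of_bool_def split: if_splits)
  ultimately show ?thesis
    by (simp add: measure_pmf_single)
qed

lemma bernoulli_dist_unit_dists: "bernoulli_dist \<mu> \<in> unit_dists"
proof -
  have "prob_space (bernoulli_dist \<mu>)"
    unfolding bernoulli_dist_def by (rule measure_pmf.prob_space_distr) simp
  then have "real_distribution (bernoulli_dist \<mu>)"
    by (simp add: real_distribution_def real_distribution_axioms_def bernoulli_dist_def)
  moreover have "of_bool -` {0..1::real} = UNIV"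
    by auto
  ultimately show ?thesis
    by (simp add: unit_dists_def bernoulli_dist_def measure_distr)
qed

text \<open>Clipping to [0,1] does not increase distances. Hence shifted Bernoulli families are
  admissible even when the shifted mean leaves [0,1].\<close>

lemma kolmogorov_dist_bernoulli_le: "kolmogorov_dist (bernoulli_dist \<mu>) (bernoulli_dist \<nu>) \<le> \<bar>\<mu> - \<nu>\<bar>"
  unfolding kolmogorov_dist_def by (rule cSUP_least) (auto simp: cdf_bernoulli_dist)

text \<open>Turns membership in the ambiguity set into bounds at each threshold; the real supremum
  dominates every value because all values are at most 1.\<close>

lemma abs_cdf_diff_le_kolmogorov_dist:
  assumes "F \<in> unit_dists" "G \<in> unit_dists"
  shows "\<bar>cdf F t - cdf G t\<bar> \<le> kolmogorov_dist F G"
  unfolding kolmogorov_dist_def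
proof (rule cSUP_upper)
  show "bdd_above (range (\<lambda>y. \<bar>cdf F y - cdf G y\<bar>))"
  proof (rule bdd_aboveI2)
    show "\<bar>cdf F y - cdf G y\<bar> \<le> 1" for y
      using unit_dists_cdf(3,4)[OF assms(1), of y] unit_dists_cdf(3,4)[OF assms(2), of y] by auto
  qed
qed simp

section \<open>The worst-case regret as a maximum over Bernoulli instances\<close>

theorem theorem2:
  fixes d :: "'x \<Rightarrow> 'x \<Rightarrow> real"
    and c_o c_u q :: real
    and n :: nat
    and x :: "nat \<Rightarrow> 'x"
    and w :: "(nat \<Rightarrow> 'x) \<Rightarrow> nat \<Rightarrow> real"
    and \<pi> :: "(nat \<Rightarrow> 'x) \<Rightarrow> (nat \<Rightarrow> real) \<Rightarrow> real"
  assumes d_nonneg: "\<And>s t. d s t \<ge> 0"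
    and costs: "c_o > 0" "c_u > 0" "c_o + c_u = 1"
    and q: "q = critical_ratio c_o c_u"
    and n: "n \<ge> 1"
    and w_nonneg: "\<And>i. i \<in> {1..n} \<Longrightarrow> w x i \<ge> 0"
    and w_pos: "(\<Sum>j = 1..n. w x j) > 0"
    and \<pi>: "\<pi> = weighted_erm c_o c_u n w"
  shows "worst_case_regret c_o c_u d n \<pi> x =
    max (SUP \<mu>\<in>{0..1 - q}.
           expected_regret c_o c_u n \<pi> x (bernoulli_dist \<mu>) (\<lambda>i. bernoulli_dist (\<mu> + d (x 0) (x i))))
        (SUP \<mu>\<in>{1 - q..1}.
           expected_regret c_o c_u n \<pi> x (bernoulli_dist \<mu>) (\<lambda>i. bernoulli_dist (\<mu> - d (x 0) (x i))))"
proof -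
  have q_eq: "c_u = q" "c_o = 1 - q" and q01: "0 < q" "q < 1"
    using costs q by (auto simp: critical_ratio_def add.commute)
  let ?R = "expected_regret (1 - q) q n (weighted_erm (1 - q) q n w) x"
  let ?B = "bernoulli_dist"
  let ?\<delta> = "\<lambda>i. d (x 0) (x i)"
  let ?clip = "\<lambda>\<mu>. min (max \<mu> 0) (1 :: real)"
  let ?dens = "erm_regret_density q n (w x)"
  let ?up = "\<lambda>\<mu>. ?R (?B \<mu>) (\<lambda>i. ?B (\<mu> + ?\<delta> i))"
  let ?down = "\<lambda>\<mu>. ?R (?B \<mu>) (\<lambda>i. ?B (\<mu> - ?\<delta> i))"
  interpret U: prob_space unif01 by (rule prob_space_unif01)
  have R_eq: "?R F\<^sub>0 F = (\<integral>t. ?dens (cdf F\<^sub>0 t) (\<lambda>i. cdf (F i) t) \<partial>unif01)"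
    "integrable unif01 (\<lambda>t. ?dens (cdf F\<^sub>0 t) (\<lambda>i. cdf (F i) t))"
    if "F\<^sub>0 \<in> unit_dists" "\<And>i. i \<in> {1..n} \<Longrightarrow> F i \<in> unit_dists" for F\<^sub>0 F
    by (intro expected_regret_eq q01 w_nonneg w_pos that; assumption)+

  \<comment> \<open>As \<open>unif01\<close> has total mass 1, a bound for the integrand on [0,1) is
    a bound for the expected regret.\<close>
  have R_le: "?R F\<^sub>0 F \<le> c"
    if "F\<^sub>0 \<in> unit_dists" "\<And>i. i \<in> {1..n} \<Longrightarrow> F i \<in> unit_dists"
      and "\<And>t. 0 \<le> t \<Longrightarrow> t < 1 \<Longrightarrow> ?dens (cdf F\<^sub>0 t) (\<lambda>i. cdf (F i) t) \<le> c" for F\<^sub>0 F c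
  proof -
    have "AE t in unif01. ?dens (cdf F\<^sub>0 t) (\<lambda>i. cdf (F i) t) \<le> c"
      using AE_unif01 by (rule AE_mp) (use that in auto)
    then show ?thesis
      using R_eq[of F\<^sub>0 F] that by (auto intro!: U.integral_le_const)
  qed
  have R_le_1: "?R F\<^sub>0 F \<le> 1"
    if "F\<^sub>0 \<in> unit_dists" "\<And>i. i \<in> {1..n} \<Longrightarrow> F i \<in> unit_dists" for F\<^sub>0 F
  proof (rule R_le[OF that])
    fix t :: real
    show "?dens (cdf F\<^sub>0 t) (\<lambda>i. cdf (F i) t) \<le> 1"
      using that unit_dists_cdf(3,4) by (intro erm_regret_density_le_one q01) auto
  qed
  \<comment> \<open>On [0,1) the cdf of \<open>?B \<mu>\<close> has the constant value
    \<open>1 - ?clip \<mu>\<close>, so a constant is integrated.\<close>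
  have R_bernoulli: "?R (?B \<mu>) (\<lambda>i. ?B (\<nu> i)) = ?dens (1 - ?clip \<mu>) (\<lambda>i. 1 - ?clip (\<nu> i))" for \<mu> \<nu>
  proof -
    have "?R (?B \<mu>) (\<lambda>i. ?B (\<nu> i)) =
        (\<integral>t. ?dens (1 - ?clip \<mu>) (\<lambda>i. 1 - ?clip (\<nu> i)) \<partial>unif01)"
      unfolding R_eq(1)[OF bernoulli_dist_unit_dists bernoulli_dist_unit_dists]
    proof (rule integral_cong_AE)
      show "AE t in unif01. ?dens (cdf (?B \<mu>) t) (\<lambda>i. cdf (?B (\<nu> i)) t) =
          ?dens (1 - ?clip \<mu>) (\<lambda>i. 1 - ?clip (\<nu> i))"
        using AE_unif01 by (rule AE_mp) (auto simp: cdf_bernoulli_dist)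
    qed (use R_eq(2)[OF bernoulli_dist_unit_dists bernoulli_dist_unit_dists, THEN borel_measurable_integrable]
        in auto)
    then show ?thesis
      using U.prob_space by simp
  qed
  have bdd: "bdd_above (?up ` A)" "bdd_above (?down ` A)" for A
    by (auto intro!: bdd_aboveI2[of _ _ 1] R_le_1 bernoulli_dist_unit_dists)

  \<comment> \<open>Each threshold \<open>t\<close> is compared with a Bernoulli instance of mean
    \<open>1 - cdf F\<^sub>0 t\<close>, whose cdf has the value \<open>cdf F\<^sub>0 t\<close>
    throughout [0,1).\<close>
  have upper: "?R F\<^sub>0 F \<le> max (SUP \<mu>\<in>{0..1 - q}. ?up \<mu>) (SUP \<mu>\<in>{1 - q..1}. ?down \<mu>)"
    if F\<^sub>0: "F\<^sub>0 \<in> unit_dists" and F: "F \<in> ambiguity_set n d x F\<^sub>0" for F\<^sub>0 F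
  proof (rule R_le)
    show F_unit: "F i \<in> unit_dists" if "i \<in> {1..n}" for i
      using F that by (simp add: ambiguity_set_def)
    fix t :: real
    let ?p = "cdf F\<^sub>0 t"
    have p: "?clip (1 - ?p) = 1 - ?p"
      using unit_dists_cdf(3,4)[OF F\<^sub>0, of t] by auto
    have near: "\<bar>?p - cdf (F i) t\<bar> \<le> ?\<delta> i" "0 \<le> cdf (F i) t" "cdf (F i) t \<le> 1" if "i \<in> {1..n}" for i
      using abs_cdf_diff_le_kolmogorov_dist[OF F\<^sub>0 F_unit[OF that], of t] F that
        unit_dists_cdf(3,4)[OF F_unit[OF that], of t]
      by (auto simp: ambiguity_set_def intro: order_trans)
    show "?dens ?p (\<lambda>i. cdf (F i) t) \<le> max (SUP \<mu>\<in>{0..1 - q}. ?up \<mu>) (SUP \<mu>\<in>{1 - q..1}. ?down \<mu>)"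
    proof (cases "q \<le> ?p")
      case True
      \<comment> \<open>The density decreases in the sample cdfs here. The least admissible value is
        \<open>max 0 (?p - ?\<delta> i)\<close>, which is the clipped expression on the right; the
        mean \<open>1 - ?p\<close> lies in \<open>{0..1 - q}\<close>.\<close>
      have "?dens ?p (\<lambda>i. cdf (F i) t) \<le> ?dens ?p (\<lambda>i. 1 - ?clip (1 - ?p + ?\<delta> i))"
      proof (rule erm_regret_density_mono(1)[OF w_nonneg _ True])
        fix i assume "i \<in> {1..n}"
        then show "0 \<le> 1 - ?clip (1 - ?p + ?\<delta> i) \<and> 1 - ?clip (1 - ?p + ?\<delta> i) \<le> cdf (F i) t \<and> cdf (F i) t \<le> 1"
          using near[of i] by (simp add: min_def max_def) linarith
      qed
      also have "\<dots> = ?up (1 - ?p)"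
        by (simp only: R_bernoulli p diff_diff_eq2 diff_add_cancel add_diff_cancel_left')
      also have "\<dots> \<le> (SUP \<mu>\<in>{0..1 - q}. ?up \<mu>)"
        using True unit_dists_cdf(4)[OF F\<^sub>0, of t] by (intro cSUP_upper bdd) auto
      finally show ?thesis
        by simp
    next
      case False
      \<comment> \<open>The mirrored case: the density increases, the largest admissible value is
        \<open>min 1 (?p + ?\<delta> i)\<close>, and the mean \<open>1 - ?p\<close> lies in
        \<open>{1 - q..1}\<close>.\<close>
      have "?dens ?p (\<lambda>i. cdf (F i) t) \<le> ?dens ?p (\<lambda>i. 1 - ?clip (1 - ?p - ?\<delta> i))"
      proof (rule erm_regret_density_mono(2)[OF w_nonneg])
        fix i assume "i \<in> {1..n}"
        then show "0 \<le> cdf (F i) t \<and> cdf (F i) t \<le> 1 - ?clip (1 - ?p - ?\<delta> i) \<and> 1 - ?clip (1 - ?p - ?\<delta> i) \<le> 1"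
          using near[of i] by (simp add: min_def max_def) linarith
      qed (use False in auto)
      also have "\<dots> = ?down (1 - ?p)"
        by (simp only: R_bernoulli p diff_diff_eq2 diff_add_cancel add_diff_cancel_left')
      also have "\<dots> \<le> (SUP \<mu>\<in>{1 - q..1}. ?down \<mu>)"
        using False unit_dists_cdf(3)[OF F\<^sub>0, of t] by (intro cSUP_upper bdd) auto
      finally show ?thesis
        by simp
    qed
  qed (use F\<^sub>0 in auto)

  \<comment> \<open>Bounding a real supremum from above requires a nonempty index set; the constant
    family provides a member.\<close>
  have amb_ne: "ambiguity_set n d x F\<^sub>0 \<noteq> {}" if "F\<^sub>0 \<in> unit_dists" for F\<^sub>0
  proof -
    have "(\<lambda>_. F\<^sub>0) \<in> ambiguity_set n d x F\<^sub>0"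
      using that d_nonneg by (simp add: ambiguity_set_def kolmogorov_dist_def)
    then show ?thesis
      by blast
  qed
  have amb_le_1: "?R F\<^sub>0 F \<le> 1" if "F\<^sub>0 \<in> unit_dists" "F \<in> ambiguity_set n d x F\<^sub>0" for F\<^sub>0 F
    using that by (intro R_le_1) (auto simp: ambiguity_set_def)
  let ?V = "SUP F\<^sub>0\<in>unit_dists. SUP F\<in>ambiguity_set n d x F\<^sub>0. ?R F\<^sub>0 F"
  \<comment> \<open>Bernoulli families with means close to \<open>\<mu>\<close> are admissible and
    hence compete in both suprema.\<close>
  have lower: "?R (?B \<mu>) (\<lambda>i. ?B (\<nu> i)) \<le> ?V" if \<nu>: "\<And>i. \<bar>\<mu> - \<nu> i\<bar> \<le> ?\<delta> i" for \<mu> \<nu>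
  proof -
    have "(\<lambda>i. ?B (\<nu> i)) \<in> ambiguity_set n d x (?B \<mu>)"
      using order_trans[OF kolmogorov_dist_bernoulli_le \<nu>]
      by (simp add: ambiguity_set_def bernoulli_dist_unit_dists)
    then have "?R (?B \<mu>) (\<lambda>i. ?B (\<nu> i)) \<le> (SUP F\<in>ambiguity_set n d x (?B \<mu>). ?R (?B \<mu>) F)"
      using amb_le_1 bernoulli_dist_unit_dists by (intro cSUP_upper bdd_aboveI2[of _ _ 1]) auto
    also have "\<dots> \<le> ?V"
      using amb_le_1 amb_ne bernoulli_dist_unit_dists
      by (intro cSUP_upper bdd_aboveI2[of _ _ 1] cSUP_least) auto
    finally show ?thesis .
  qed
  have "?V = max (SUP \<mu>\<in>{0..1 - q}. ?up \<mu>) (SUP \<mu>\<in>{1 - q..1}. ?down \<mu>)"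
  proof (rule antisym)
    have "unit_dists \<noteq> {}"
      using bernoulli_dist_unit_dists by blast
    then show "?V \<le> max (SUP \<mu>\<in>{0..1 - q}. ?up \<mu>) (SUP \<mu>\<in>{1 - q..1}. ?down \<mu>)"
      using amb_ne by (intro cSUP_least upper)
    \<comment> \<open>Both ranges of \<open>\<mu>\<close> are nonempty because \<open>q\<close> lies
      strictly between 0 and 1, and the shifts by \<open>?\<delta> i\<close> meet the condition of
      \<open>lower\<close> with equality.\<close>
    show "max (SUP \<mu>\<in>{0..1 - q}. ?up \<mu>) (SUP \<mu>\<in>{1 - q..1}. ?down \<mu>) \<le> ?V"
      using q01 d_nonneg by (intro max.boundedI cSUP_least lower) auto
  qed
  then show ?thesis
    by (simp add: worst_case_regret_def \<pi> q_eq)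
qed

end
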